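(* Let $\mathcal F_{P}$, $\mathcal F_{D}$ be the feasible sets of the single-cone SOCO primal and dual problems, and $\mathcal F_{P}^{SDO}$, $\mathcal F_{D}^{SDO}$ the feasible sets of the SDO pair built from arrow-head data $\vec A_i=\mathrm{Arw}(a_{(i)})$, $\vec C=\mathrm{Arw}(c)$ (all defined in the context). Define the point-to-set mapping $\mathcal M$ as follows: for $(\bar x,\bar y,\bar s)\in\mathcal F_P\times\mathcal F_D$, $\mathcal M(\bar x,\bar y,\bar s)$ consists of all $(X,y,S)$ with $$S=\mathrm{Arw}(\bar s),\qquad y=\bar y,\qquad X\in\mathbb S^n,\ X\succeq 0,\ \sum_{i=1}^n X_{ii}=\bar x_1,\ X_{1j}=\frac{\bar x_j}{2}\ (j=2,\dots,n).$$ Define the inverse mapping $\mathcal M^{-1}$ as follows: for $(X,y,S)\in\mathcal F_{P}^{SDO}\times\mathcal F_{D}^{SDO}$, $\mathcal M^{-1}(X,y,S)=(\bar x,\bar y,\bar s)$ with $$\bar s=\mathrm{Arw}^{-1}(S),\qquad \bar y=y,\qquad \bar x=\Big(\sum_{i=1}^n X_{ii},\,2X_{12},\,\dots,\,2X_{1n}\Big)^T .$$ Then $\mathcal M$ is a point-to-set admissible mapping, and $\mathcal M^{-1}$ is a point-to-point admissible mapping.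
   Context: Data: $A\in\mathbb R^{m\times n}$ with entries $a_{ij}$ and $i$-th row $a_{(i)}$, $b\in\mathbb R^m$, $c\in\mathbb R^n$. $\mathcal L^n=\{x\in\mathbb R^n: x_1\ge\|x_{2:n}\|_2\}$, where $x_{2:n}=(x_2,\dots,x_n)$. $\mathbb S^n$ is the set of real symmetric $n\times n$ matrices. For $x\in\mathbb R^n$, $$\mathrm{Arw}(x)=\begin{pmatrix}x_1 & x_{2:n}^T\\ x_{2:n}& x_1I_{n-1}\end{pmatrix},$$ and $\mathrm{Arw}^{-1}$ recovers $x$ from an arrow-head matrix (feasible $S$ below are linear combinations of arrow-head matrices, hence of this form). SOCO pair: $\min\{c^T\bar x: A\bar x=b,\ \bar x\in\mathcal L^n\}$ and $\max\{b^T\bar y: A^T\bar y+\bar s=c,\ \bar s\in\mathcal L^n\}$, with feasible sets $\mathcal F_P$ (of $\bar x$) and $\mathcal F_D$ (of $(\bar y,\bar s)$). SDO pair: with $\vec A_i=\mathrm{Arw}(a_{(i)})$, $i=1,\dots,m$, and $\vec C=\mathrm{Arw}(c)$: $\min\{\mathrm{Tr}(\vec CX):\mathrm{Tr}(\vec A_iX)=b_i,\ i=1,\dots,m,\ X\succeq0\}$ and $\max\{b^Ty:\sum_{i=1}^m y_i\vec A_i+S=\vec C,\ S\succeq 0\}$, with feasible sets $\mathcal F_P^{SDO}\subseteq\mathbb S^n$ and $\mathcal F_D^{SDO}\subseteq\mathbb R^m\times\mathbb S^n$. Admissible: a mapping $\mathcal M$ (with its inverse mapping $\mathcal M^{-1}$)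 is admissible if it preserves feasibility and objective values, i.e. $(\bar x,\bar y,\bar s)\in\mathcal F_P\times\mathcal F_D\Rightarrow\mathcal M(\bar x,\bar y,\bar s)\in\mathcal F_P^{SDO}\times\mathcal F_D^{SDO}$ (for a point-to-set map: every element of the image lies in this set); $(X,y,S)\in\mathcal F_P^{SDO}\times\mathcal F_D^{SDO}\Rightarrow\mathcal M^{-1}(X,y,S)\in\mathcal F_P\times\mathcal F_D$; and $c^T\bar x=\mathrm{Tr}(\vec CX)$, $b^T\bar y=b^Ty$ for corresponding points. *)

theory Defs
  imports "HOL-Analysis.Analysis"
begin

text \<open>
  Coordinates of \<open>\<real>\<^sup>n\<close> are indexed by a finite linearly ordered type; its least
  element plays the role of the index \<open>1\<close>.
  The abbreviations spell out \<open>vec\<close>, because the notation \<open>real ^ 'n\<close> would force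
  the full sort of \<open>'n\<close> to be repeated at every occurrence.
\<close>

type_synonym 'n rvec = "(real, 'n) vec"
type_synonym ('m, 'n) rmat = "((real, 'n) vec, 'm) vec"

definition first :: "'n::{finite,linorder}" where
  "first = Min UNIV"

definition lorentz_cone :: "('n::{finite,linorder}) rvec set" where
  "lorentz_cone = {x. x $ first \<ge> L2_set (\<lambda>j. x $ j) (UNIV - {first})}"

definition Arw :: "('n::{finite,linorder}) rvec \<Rightarrow> ('n, 'n) rmat" where
  "Arw x = (\<chi> i j. if i = j then x $ first
                   else if i = first then x $ j
                   else if j = first then x $ i
                   else 0)"

definition sym_mats :: "('n::finite, 'n) rmat set" where
  "sym_mats = {X. transpose X = X}"

definition psd :: "('n::finite, 'n) rmat \<Rightarrow> bool" where
  "psd X \<longleftrightarrow> X \<in> sym_mats \<and> (\<forall>v. 0 \<le> v \<bullet> (X *v v))"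

definition soco_primal ::
  "('m::finite, 'n::{finite,linorder}) rmat \<Rightarrow> 'm rvec \<Rightarrow> 'n rvec set" where
  "soco_primal A b = {x. A *v x = b \<and> x \<in> lorentz_cone}"

definition soco_dual ::
  "('m::finite, 'n::{finite,linorder}) rmat \<Rightarrow> 'n rvec \<Rightarrow> ('m rvec \<times> 'n rvec) set" where
  "soco_dual A c = {(y, s). transpose A *v y + s = c \<and> s \<in> lorentz_cone}"

definition sdo_primal ::
  "('m::finite \<Rightarrow> ('n::finite, 'n) rmat) \<Rightarrow> 'm rvec \<Rightarrow> ('n, 'n) rmat set" where
  "sdo_primal As b = {X \<in> sym_mats. (\<forall>i. trace (As i ** X) = b $ i) \<and> psd X}"

definition sdo_dual ::
  "('m::finite \<Rightarrow> ('n::finite, 'n) rmat) \<Rightarrow> ('n, 'n) rmat \<Rightarrow> ('m rvec \<times> ('n, 'n) rmat) set" where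
  "sdo_dual As C =
     {(y, S). S \<in> sym_mats \<and> (\<Sum>i\<in>UNIV. y $ i *\<^sub>R As i) + S = C \<and> psd S}"

definition arw_rows :: "('m::finite, 'n::{finite,linorder}) rmat \<Rightarrow> 'm \<Rightarrow> ('n, 'n) rmat" where
  "arw_rows A i = Arw (row i A)"

definition soco_feasible ::
  "('m::finite, 'n::{finite,linorder}) rmat \<Rightarrow> 'm rvec \<Rightarrow> 'n rvec \<Rightarrow>
     ('n rvec \<times> 'm rvec \<times> 'n rvec) set" where
  "soco_feasible A b c = soco_primal A b \<times> soco_dual A c"

definition sdo_feasible ::
  "('m::finite, 'n::{finite,linorder}) rmat \<Rightarrow> 'm rvec \<Rightarrow> 'n rvec \<Rightarrow>
     (('n, 'n) rmat \<times> 'm rvec \<times> ('n, 'n) rmat) set" where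
  "sdo_feasible A b c = sdo_primal (arw_rows A) b \<times> sdo_dual (arw_rows A) (Arw c)"

definition same_objectives ::
  "('m::finite) rvec \<Rightarrow> ('n::{finite,linorder}) rvec \<Rightarrow> 'n rvec \<times> 'm rvec \<times> 'n rvec \<Rightarrow>
     ('n, 'n) rmat \<times> 'm rvec \<times> ('n, 'n) rmat \<Rightarrow> bool" where
  "same_objectives b c = (\<lambda>(xb, yb, sb) (X, y, S).
     c \<bullet> xb = trace (Arw c ** X) \<and> b \<bullet> yb = b \<bullet> y)"

definition point_to_set_admissible ::
  "('m::finite, 'n::{finite,linorder}) rmat \<Rightarrow> 'm rvec \<Rightarrow> 'n rvec \<Rightarrow>
     ('n rvec \<times> 'm rvec \<times> 'n rvec \<Rightarrow>
       (('n, 'n) rmat \<times> 'm rvec \<times> ('n, 'n) rmat) set) \<Rightarrow> bool" where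
  "point_to_set_admissible A b c F \<longleftrightarrow>
     (\<forall>p \<in> soco_feasible A b c. \<forall>q \<in> F p.
        q \<in> sdo_feasible A b c \<and> same_objectives b c p q)"

definition point_to_point_admissible ::
  "('m::finite, 'n::{finite,linorder}) rmat \<Rightarrow> 'm rvec \<Rightarrow> 'n rvec \<Rightarrow>
     (('n, 'n) rmat \<times> 'm rvec \<times> ('n, 'n) rmat \<Rightarrow>
       'n rvec \<times> 'm rvec \<times> 'n rvec) \<Rightarrow> bool" where
  "point_to_point_admissible A b c G \<longleftrightarrow>
     (\<forall>q \<in> sdo_feasible A b c.
        G q \<in> soco_feasible A b c \<and> same_objectives b c (G q) q)"

definition map_M ::
  "('n::{finite,linorder}) rvec \<times> ('m::finite) rvec \<times> 'n rvec \<Rightarrow>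
     (('n, 'n) rmat \<times> 'm rvec \<times> ('n, 'n) rmat) set" where
  "map_M = (\<lambda>(xb, yb, sb). {(X, y, S).
     S = Arw sb \<and> y = yb \<and> X \<in> sym_mats \<and> psd X \<and>
     (\<Sum>i\<in>UNIV. X $ i $ i) = xb $ first \<and>
     (\<forall>j. j \<noteq> first \<longrightarrow> X $ first $ j = xb $ j / 2)})"

text \<open>
  \<open>Arw\<close> is injective, so \<open>inv Arw\<close> recovers \<open>x\<close> from \<open>Arw x\<close>; its value at matrices that are
  not arrow-head is unspecified, but dual feasible \<open>S\<close> are arrow-head.
\<close>

definition map_M_inv ::
  "('n::{finite,linorder}, 'n) rmat \<times> ('m::finite) rvec \<times> ('n, 'n) rmat \<Rightarrow>
     'n rvec \<times> 'm rvec \<times> 'n rvec" where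
  "map_M_inv = (\<lambda>(X, y, S).
     ((\<chi> j. if j = first then (\<Sum>i\<in>UNIV. X $ i $ i) else 2 * X $ first $ j), y, inv Arw S))"

end

theory Submission
  imports Defs
begin

text \<open>
  Trace pairing with an arrow-head matrix sees a symmetric \<open>X\<close> only through its trace and the
  off-diagonal part of its first row, i.e. through the vector
  \<open>(tr X, 2 X\<^sub>1\<^sub>2, \<dots>, 2 X\<^sub>1\<^sub>n)\<close>; this gives the primal equations and both objectives. On the
  dual side \<open>Arw\<close> is linear and injective, and \<open>Arw s\<close> is positive semidefinite exactly when \<open>s\<close>
  lies in the Lorentz cone. Finally, the \<open>2 \<times> 2\<close> minors of \<open>X \<succeq> 0\<close> give
  \<open>4 \<Sum>\<^sub>j X\<^sub>1\<^sub>j\<^sup>2 \<le> 4 X\<^sub>1\<^sub>1 (tr X - X\<^sub>1\<^sub>1) \<le> (tr X)\<^sup>2\<close>, so that vector is in the cone.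
\<close>

text \<open>On symmetric matrices, this is the adjoint of \<open>Arw\<close> for the trace pairing.
  It is also the primal component of \<open>map_M_inv\<close>.\<close>

definition arrow_part :: "('n::{finite,linorder}, 'n) rmat \<Rightarrow> 'n rvec" where
  "arrow_part X = (\<chi> j. if j = first then (\<Sum>i\<in>UNIV. X $ i $ i) else 2 * X $ first $ j)"

lemma sum_UNIV_first:
  fixes f :: "'n::{finite,linorder} \<Rightarrow> real"
  shows "(\<Sum>i\<in>UNIV. f i) = f first + (\<Sum>i\<in>UNIV - {first}. f i)"
  by (rule sum.remove) auto

lemma sym_mats_swap: "X \<in> sym_mats \<Longrightarrow> X $ i $ j = X $ j $ i"
  by (auto simp: sym_mats_def transpose_def vec_eq_iff)

lemma Arw_in_sym_mats: "Arw x \<in> sym_mats"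
  by (auto simp: sym_mats_def transpose_def vec_eq_iff Arw_def)

lemma linear_Arw: "linear Arw"
  by (rule linearI) (auto simp: Arw_def vec_eq_iff)

lemma inj_Arw: "inj Arw"
proof (rule injI)
  fix x y :: "'n::{finite,linorder} rvec"
  assume eq: "Arw x = Arw y"
  have "x $ j = y $ j" for j
  proof -
    have "Arw x $ first $ j = Arw y $ first $ j" by (simp add: eq)
    then show ?thesis by (auto simp: Arw_def split: if_splits)
  qed
  then show "x = y" by (simp add: vec_eq_iff)
qed

lemma Arw_mult_vec:
  "(Arw x *v v) $ i =
     (if i = first then x \<bullet> v else x $ i * v $ first + x $ first * v $ i)"
proof (cases "i = first")
  case True
  then show ?thesis
    by (auto simp: matrix_vector_mult_def inner_vec_def Arw_def intro!: sum.cong)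
next
  case False
  have "(Arw x *v v) $ i = (\<Sum>j\<in>UNIV. Arw x $ i $ j * v $ j)"
    by (simp add: matrix_vector_mult_def)
  also have "\<dots> = (\<Sum>j\<in>UNIV. (if j = i then x $ first * v $ i else 0) +
      (if j = first then x $ i * v $ first else 0))"
    using False by (intro sum.cong) (auto simp: Arw_def)
  also have "\<dots> = x $ first * v $ i + x $ i * v $ first"
    by (simp add: sum.distrib)
  finally show ?thesis using False by simp
qed

lemma trace_Arw_mult:
  assumes "X \<in> sym_mats"
  shows "trace (Arw x ** X) = x \<bullet> arrow_part X"
proof -
  have entry: "(Arw x ** X) $ i $ i = (Arw x *v column i X) $ i" for i
    by (simp add: matrix_matrix_mult_def matrix_vector_mult_def column_def)
  have "trace (Arw x ** X) = x \<bullet> column first X +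
      (\<Sum>i\<in>UNIV - {first}. x $ i * X $ first $ i + x $ first * X $ i $ i)"
    unfolding trace_def entry Arw_mult_vec
    by (subst sum_UNIV_first) (auto simp: column_def intro!: sum.cong)
  \<comment> \<open>By symmetry each off-diagonal entry \<open>X $ first $ i\<close> now occurs
    twice, which is the origin of the factor 2 in \<open>arrow_part\<close>.\<close>
  also have "x \<bullet> column first X =
      x $ first * X $ first $ first + (\<Sum>i\<in>UNIV - {first}. x $ i * X $ first $ i)"
    unfolding inner_vec_def
    by (subst sum_UNIV_first) (auto simp: column_def intro!: sum.cong sym_mats_swap[OF assms])
  also have "\<dots> + (\<Sum>i\<in>UNIV - {first}. x $ i * X $ first $ i + x $ first * X $ i $ i) =
      x \<bullet> arrow_part X"
    by (simp add: inner_vec_def arrow_part_def sum_UNIV_first sum.distrib sum_distrib_left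
        algebra_simps)
  finally show ?thesis .
qed

lemma inner_Arw_mult_vec:
  "v \<bullet> (Arw x *v v) = x $ first * ((v $ first)\<^sup>2 + (\<Sum>j\<in>UNIV - {first}. (v $ j)\<^sup>2)) +
     2 * v $ first * (\<Sum>j\<in>UNIV - {first}. x $ j * v $ j)"
proof -
  have "v \<bullet> (Arw x *v v) = v $ first * (x \<bullet> v) +
      (\<Sum>j\<in>UNIV - {first}. v $ j * (x $ j * v $ first + x $ first * v $ j))"
    by (subst inner_vec_def, subst sum_UNIV_first) (simp add: Arw_mult_vec)
  also have "x \<bullet> v = x $ first * v $ first + (\<Sum>j\<in>UNIV - {first}. x $ j * v $ j)"
    by (simp add: inner_vec_def sum_UNIV_first)
  finally show ?thesis
    by (simp add: sum.distrib sum_distrib_left algebra_simps power2_eq_square)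
qed

lemma psd_Arw_iff: "psd (Arw x) \<longleftrightarrow> x \<in> lorentz_cone"
proof
  let ?J = "UNIV - {first}"
  define N where "N = L2_set (\<lambda>j. x $ j) ?J"
  have N0: "0 \<le> N" by (simp add: N_def)
  have N2: "(\<Sum>j\<in>?J. (x $ j)\<^sup>2) = N\<^sup>2"
    by (simp add: N_def L2_set_def sum_nonneg)
  {
    assume "psd (Arw x)"
    then have pos: "0 \<le> v \<bullet> (Arw x *v v)" for v by (simp add: psd_def)
    have "0 \<le> x $ first * (1\<^sup>2 + (\<Sum>j\<in>?J. (0::real)\<^sup>2))"
      using pos[of "\<chi> j. if j = first then 1 else 0"]
      by (simp add: inner_Arw_mult_vec)
    then have x0: "0 \<le> x $ first" by simp
    \<comment> \<open>The test vector (N, -x_{2:n}) attains equality in Cauchy-Schwarz, which makes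
      the cross term as negative as possible.\<close>
    have "0 \<le> x $ first * (N\<^sup>2 + (\<Sum>j\<in>?J. (x $ j)\<^sup>2)) + 2 * N * (\<Sum>j\<in>?J. - (x $ j)\<^sup>2)"
      using pos[of "\<chi> j. if j = first then N else - x $ j"]
      by (simp add: inner_Arw_mult_vec power2_eq_square)
    then have "0 \<le> 2 * N\<^sup>2 * (x $ first - N)"
      by (simp add: sum_negf N2 algebra_simps)
    \<comment> \<open>For N = 0 the previous inequality is void, and the bound \<open>x0\<close>
      from the first unit vector supplies the claim.\<close>
    then have "N \<le> x $ first"
      using x0 by (cases "N = 0") (simp_all add: zero_le_mult_iff)
    then show "x \<in> lorentz_cone" by (simp add: lorentz_cone_def N_def)
  next
    assume "x \<in> lorentz_cone"
    then have Nx: "N \<le> x $ first" by (simp add: lorentz_cone_def N_def)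
    have "0 \<le> v \<bullet> (Arw x *v v)" for v
    proof -
      define t where "t = L2_set (\<lambda>j. v $ j) ?J"
      let ?s = "\<Sum>j\<in>?J. x $ j * v $ j"
      have t0: "0 \<le> t" by (simp add: t_def)
      have t2: "(\<Sum>j\<in>?J. (v $ j)\<^sup>2) = t\<^sup>2"
        by (simp add: t_def L2_set_def sum_nonneg)
      have "\<bar>?s\<bar> \<le> (\<Sum>j\<in>?J. \<bar>x $ j\<bar> * \<bar>v $ j\<bar>)"
        by (rule order_trans[OF sum_abs]) (simp add: abs_mult)
      also have "\<dots> \<le> N * t"
        unfolding N_def t_def by (rule L2_set_mult_ineq)
      finally have s: "\<bar>?s\<bar> \<le> N * t" .
      have "\<bar>2 * v $ first * ?s\<bar> \<le> 2 * \<bar>v $ first\<bar> * (N * t)"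
        using mult_left_mono[OF s, of "2 * \<bar>v $ first\<bar>"] by (simp add: abs_mult)
      also have "\<dots> = N * (2 * \<bar>v $ first\<bar> * t)" by simp
      \<comment> \<open>AM-GM lets the square terms of the form absorb the cross term.\<close>
      also have "\<dots> \<le> N * ((v $ first)\<^sup>2 + t\<^sup>2)"
        using sum_squares_bound[of "\<bar>v $ first\<bar>" t] N0 by (intro mult_left_mono) auto
      also have "\<dots> \<le> x $ first * ((v $ first)\<^sup>2 + t\<^sup>2)"
        using Nx by (intro mult_right_mono) auto
      finally show ?thesis unfolding inner_Arw_mult_vec t2 by linarith
    qed
    then show "psd (Arw x)" by (simp add: psd_def Arw_in_sym_mats)
  }
qed

text \<open>The points (r, -q) and (-q, p) turn the form into the determinant times r and times p,
  which settles the case of a positive diagonal coefficient. If p = r = 0, the point (1, -q) forces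
  q = 0.\<close>

lemma binary_quadratic_form_nonneg_imp:
  fixes p q r :: real
  assumes nonneg: "\<And>\<alpha> \<beta>. 0 \<le> \<alpha>\<^sup>2 * p + 2 * \<alpha> * \<beta> * q + \<beta>\<^sup>2 * r"
  shows "0 \<le> p" "0 \<le> r" "q\<^sup>2 \<le> p * r"
proof -
  show p: "0 \<le> p" using nonneg[of 1 0] by simp
  show r: "0 \<le> r" using nonneg[of 0 1] by simp
  have 1: "0 \<le> r * (p * r - q\<^sup>2)"
    using nonneg[of r "- q"] by (simp add: algebra_simps power2_eq_square)
  have 2: "0 \<le> p * (p * r - q\<^sup>2)"
    using nonneg[of "- q" p] by (simp add: algebra_simps power2_eq_square)
  have 3: "2 * q\<^sup>2 \<le> p + q\<^sup>2 * r"
    using nonneg[of 1 "- q"] by (simp add: algebra_simps power2_eq_square)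
  show "q\<^sup>2 \<le> p * r"
  proof (cases "0 < p \<or> 0 < r")
    case True
    with 1 2 show ?thesis by (auto simp: zero_le_mult_iff)
  next
    case False
    with 3 p r show ?thesis by auto
  qed
qed

text \<open>Testing \<open>X\<close> on the span of two basis vectors yields the binary form whose
  determinant is the 2 x 2 minor at i, j.\<close>

lemma psd_two_by_two:
  assumes "psd X" "i \<noteq> j"
  shows "0 \<le> \<alpha>\<^sup>2 * X $ i $ i + 2 * \<alpha> * \<beta> * X $ i $ j + \<beta>\<^sup>2 * X $ j $ j"
proof -
  let ?v = "\<alpha> *\<^sub>R axis i 1 + \<beta> *\<^sub>R axis j 1 :: 'a rvec"
  have sym: "X $ j $ i = X $ i $ j"
    using assms(1) by (auto simp: psd_def intro: sym_mats_swap)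
  have "0 \<le> ?v \<bullet> (X *v ?v)" using assms(1) by (simp add: psd_def)
  also have "X *v ?v = \<alpha> *\<^sub>R column i X + \<beta> *\<^sub>R column j X"
    by (simp add: matrix_vector_right_distrib matrix_vector_mult_scaleR
        matrix_vector_mult_basis)
  also have "?v \<bullet> \<dots> = \<alpha>\<^sup>2 * X $ i $ i + 2 * \<alpha> * \<beta> * X $ i $ j + \<beta>\<^sup>2 * X $ j $ j"
    by (simp add: inner_add_left inner_axis' column_def sym algebra_simps power2_eq_square)
  finally show ?thesis .
qed

lemma psd_diag_nonneg:
  assumes "psd X"
  shows "0 \<le> X $ i $ i"
proof -
  have "0 \<le> axis i 1 \<bullet> (X *v axis i 1)" using assms by (simp add: psd_def)
  then show ?thesis by (simp add: matrix_vector_mult_basis inner_axis' column_def)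
qed

lemma arrow_part_in_lorentz_cone:
  fixes X :: "('n::{finite,linorder}, 'n) rmat"
  assumes "psd X"
  shows "arrow_part X \<in> lorentz_cone"
proof -
  let ?J = "UNIV - {first :: 'n}"
  define p where "p = X $ first $ first"
  define q where "q = (\<Sum>j\<in>?J. X $ j $ j)"
  have pq: "0 \<le> p" "0 \<le> q"
    by (auto simp: p_def q_def intro!: sum_nonneg psd_diag_nonneg assms)
  \<comment> \<open>Each summand is bounded by the minor on the indices \<open>first\<close> and
    j.\<close>
  have "(\<Sum>j\<in>?J. (2 * X $ first $ j)\<^sup>2) \<le> (\<Sum>j\<in>?J. 4 * (p * X $ j $ j))"
    using binary_quadratic_form_nonneg_imp(3)[OF psd_two_by_two[OF assms]]
    by (intro sum_mono) (auto simp: p_def power_mult_distrib)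
  also have "\<dots> = 4 * (p * q)" by (simp add: q_def sum_distrib_left)
  \<comment> \<open>This is (p - q)^2 \<ge> 0.\<close>
  also have "\<dots> \<le> (p + q)\<^sup>2"
    using sum_squares_bound[of p q] by (simp add: power2_sum)
  finally have "L2_set (\<lambda>j. 2 * X $ first $ j) ?J \<le> p + q"
    using pq by (simp add: L2_set_def real_le_lsqrt)
  moreover have "L2_set (\<lambda>j. arrow_part X $ j) ?J = L2_set (\<lambda>j. 2 * X $ first $ j) ?J"
    by (rule L2_set_cong) (auto simp: arrow_part_def)
  moreover have "arrow_part X $ first = p + q"
    by (simp add: arrow_part_def sum_UNIV_first p_def q_def)
  ultimately show ?thesis by (simp add: lorentz_cone_def)
qed

text \<open>Linearity collapses the SDO dual constraint into an equation in which injectivity can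
  cancel \<open>Arw\<close>.\<close>

lemma sum_arw_rows: "(\<Sum>i\<in>UNIV. y $ i *\<^sub>R arw_rows A i) = Arw (transpose A *v y)"
proof -
  have "transpose A *v y = (\<Sum>i\<in>UNIV. y $ i *\<^sub>R row i A)"
    by (simp add: matrix_mult_sum scalar_mult_eq_scaleR)
  then show ?thesis
    by (simp add: linear_sum[OF linear_Arw] linear_scale[OF linear_Arw] arw_rows_def)
qed

lemma Arw_in_sdo_dual_iff:
  "(y, Arw s) \<in> sdo_dual (arw_rows A) (Arw c) \<longleftrightarrow> (y, s) \<in> soco_dual A c"
  by (simp add: sdo_dual_def soco_dual_def sum_arw_rows psd_Arw_iff Arw_in_sym_mats
      linear_add[OF linear_Arw, symmetric] inj_eq[OF inj_Arw])

text \<open>The constraint determines the slack, so it lies in the range of \<open>Arw\<close>,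
  where \<open>inv Arw\<close> is a genuine inverse.\<close>

lemma sdo_dual_arrow_head:
  assumes "(y, S) \<in> sdo_dual (arw_rows A) (Arw c)"
  shows "S = Arw (c - transpose A *v y)"
  using assms
  by (auto simp: sdo_dual_def sum_arw_rows linear_diff[OF linear_Arw] algebra_simps)

lemma sdo_primal_iff:
  "X \<in> sdo_primal (arw_rows A) b \<longleftrightarrow> psd X \<and> A *v arrow_part X = b"
proof -
  have "(\<forall>i. trace (arw_rows A i ** X) = b $ i) \<longleftrightarrow> A *v arrow_part X = b"
    if "X \<in> sym_mats"
    by (simp add: arw_rows_def trace_Arw_mult[OF that] vec_eq_iff matrix_vector_mul_component
        row_def)
  then show ?thesis by (auto simp: sdo_primal_def psd_def)
qed

text \<open>The primal part of the image is the fibre of \<open>arrow_part\<close> over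
  \<open>xb\<close> among positive semidefinite matrices, so both mappings rest on the same linear
  map.\<close>

lemma mem_map_M_iff:
  "(X, y, S) \<in> map_M (xb, yb, sb) \<longleftrightarrow>
     S = Arw sb \<and> y = yb \<and> psd X \<and> arrow_part X = xb"
proof -
  have "arrow_part X = xb \<longleftrightarrow> (\<Sum>i\<in>UNIV. X $ i $ i) = xb $ first \<and>
      (\<forall>j. j \<noteq> first \<longrightarrow> X $ first $ j = xb $ j / 2)"
    unfolding arrow_part_def vec_eq_iff by (auto simp: field_simps)
  then show ?thesis by (auto simp: map_M_def psd_def)
qed

lemma map_M_inv_eq: "map_M_inv (X, y, S) = (arrow_part X, y, inv Arw S)"
  by (simp add: map_M_inv_def arrow_part_def)

lemma same_objectives_arrow_part:
  "psd X \<Longrightarrow> same_objectives b c (arrow_part X, y, s) (X, y, S)"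
  by (simp add: same_objectives_def trace_Arw_mult psd_def)

theorem theorem3p1:
  fixes A :: "('m::finite, 'n::{finite,linorder}) rmat"
    and b :: "'m rvec"
    and c :: "'n rvec"
  shows "point_to_set_admissible A b c map_M \<and> point_to_point_admissible A b c map_M_inv"
proof
  show "point_to_set_admissible A b c map_M"
    unfolding point_to_set_admissible_def
    by (auto simp: soco_feasible_def sdo_feasible_def mem_map_M_iff sdo_primal_iff
        soco_primal_def Arw_in_sdo_dual_iff same_objectives_arrow_part)
  show "point_to_point_admissible A b c map_M_inv"
    unfolding point_to_point_admissible_def
  proof clarify
    fix X y S
    assume "(X, y, S) \<in> sdo_feasible A b c"
    then have X: "psd X" "A *v arrow_part X = b"
      and D: "(y, S) \<in> sdo_dual (arw_rows A) (Arw c)"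
      by (auto simp: sdo_feasible_def sdo_primal_iff)
    obtain s where S: "S = Arw s" using sdo_dual_arrow_head[OF D] by blast
    have "(y, s) \<in> soco_dual A c" using D by (simp add: S Arw_in_sdo_dual_iff)
    \<comment> \<open>The primal equation is already \<open>X(2)\<close>; membership of
      \<open>arrow_part X\<close> in the cone comes from the 2 x 2 minors.\<close>
    then show "map_M_inv (X, y, S) \<in> soco_feasible A b c \<and>
        same_objectives b c (map_M_inv (X, y, S)) (X, y, S)"
      using X by (simp add: map_M_inv_eq S inv_f_f[OF inj_Arw] soco_feasible_def
          soco_primal_def arrow_part_in_lorentz_cone same_objectives_arrow_part)
  qed
qed

end
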